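(* Let $G=(V,E,O,Pr)$ be a parity game and $J^0$ a safe justification for $G$ (for instance $J^0=(V,\emptyset,H_d)$). Consider any sequence $J^0,J^1,J^2,\dots$ in which each $J^{i+1}=\mathrm{Justify}(J^i,v_i,dj_i)$ for some node $v_i$ and direct justification $dj_i$ such that this operation is executable, and which is continued as long as $J^i$ has an unjustified node. Then every such sequence is finite and ends in a safe justification $J^k=(V,D^k,H^k)$ without unjustified nodes; $H^k$ is the winning function of $G$, and $\sigma_{J^k,0}$, $\sigma_{J^k,1}$ are winning strategies for players $0$ and $1$ on the nodes they win.
   Context: A parity game is $G=(V,E,O,Pr)$ with finite node set $V$, moves $E\subseteq V\times V$ (every node has an outgoing edge), owner $O:V\to\{0,1\}$ and priority $Pr:V\to\mathbb{N}$; $\bar\alpha=1-\alpha$, $O_\alpha=\{v\mid O(v)=\alpha\}$. A play of $G$ is an infinite path along $E$, won by player $(m\bmod 2)$ where $m$ is the highest priority occurring infinitely often. A strategy for $\alpha$ is a partial function $\sigma$ from a subset of $O_\alpha$ to $V$; a play is consistent with $\sigma$ if $v_{i+1}=\sigma(v_i)$ whenever $v_i\in dom(\sigma)$. The winning function $W:V\to\{0,1\}$ of $G$ maps each node to the player who has a strategy winning all plays from it consistent with that strategy; a winning strategy for $\alpha$ on the nodes it wins is one such that every play starting in a node $v$ with $W(v)=\alpha$ consistent with it is won by $\alpha$. A direct justification for $\alpha$ to win $v$: one outgoing edge of $v$ if $O(v)=\alpha$, all outgoing edges of $v$ if $O(v)=\bar\alpha$; it wins $v$ for $\alpha$ under $H:V\to\{0,1\}$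 if $H(w)=\alpha$ for all its edges $(v,w)$. A justification is $J=(V,D,H)$ with $D\subseteq E$, $H:V\to\{0,1\}$; $v$ is justified if it has outgoing edges in $D$, unjustified otherwise. $J$ is weakly winning if each justified node's set of outgoing $D$-edges is a direct justification winning it for $H(v)$ under $H$; $J$ is winning if moreover every infinite path $v_1,v_2,\dots$ in $(V,D)$ is won by $H(v_1)$. For a justification $J$, $\sigma_{J,\alpha}=\{(v,w)\in D\mid O(v)=H(v)=\alpha\}$. Let $\downarrow v$ be the set of nodes from which $v$ is reachable in $(V,D)$ (including $v$). The justification level $jl_J(v)$ is the minimum priority of unjustified nodes reachable from $v$ in $(V,D)$ (including $v$), or $+\infty$ if none; for $dj=\{(v,w_1),\dots,(v,w_k)\}$, $jl_J(dj)=\min_i jl_J(w_i)$. The default hypothesis is $H_d(v)=Pr(v)\bmod 2$. $J$ is safe if (i) $J$ is winning, (ii) $H(v)=H_d(v)$ for all unjustified $v$, (iii) $jl_J(v)\ge Pr(v)$ for all $v$. $J[v:dj,\alpha]$ replaces the outgoing $D$-edges of $v$ by $dj$ and sets $H(v):=\alpha$; $J[w:\emptyset,H_d(w)\mid w\in S]$ removes all outgoing $D$-edges of each $w\in S$ and sets $H(w):=H_d(w)$; modifications apply left to right. $\mathrm{Justify}(J,v,dj)$ is executable if: (1) $J$ is safe and there is a player $\alpha$ such that $dj$ is a direct justification winning $v$ for $\alpha$ under $H$; (2) if $v$ is unjustified then $jl_J(dj)\ge jl_J(v)$, if $v$ is justified then $jl_J(dj)>jl_J(v)$. Then $\mathrm{Justify}(J,v,dj)=J[v:dj,\alpha]$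 if $H(v)=\alpha$, and $=J[w:\emptyset,H_d(w)\mid w\in\downarrow v][v:dj,\alpha]$ if $H(v)=\bar\alpha$.
   Formalization: Strategies are required to choose moves in E; with arbitrary partial functions into V, a strategy prescribing a non-edge has no consistent plays and wins vacuously, so the winning function would not be well defined. *)

theory Defs
  imports Main "HOL-Library.Extended_Nat"
begin

text \<open>Players are the natural numbers 0 and 1. Owner, priority and hypothesis functions are total
  in the logic; only their values on the node set matter.\<close>

record 'v parity_game =
  nodes :: "'v set"
  moves :: "('v \<times> 'v) set"
  owner :: "'v \<Rightarrow> nat"
  prio  :: "'v \<Rightarrow> nat"

definition parity_game :: "'v parity_game \<Rightarrow> bool" where
  "parity_game G \<longleftrightarrow>
     finite (nodes G) \<and>
     moves G \<subseteq> nodes G \<times> nodes G \<and>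
     (\<forall>v\<in>nodes G. \<exists>w. (v, w) \<in> moves G) \<and>
     (\<forall>v\<in>nodes G. owner G v \<in> {0, 1})"

definition infinite_path :: "('v \<times> 'v) set \<Rightarrow> (nat \<Rightarrow> 'v) \<Rightarrow> bool" where
  "infinite_path R p \<longleftrightarrow> (\<forall>i. (p i, p (Suc i)) \<in> R)"

definition play :: "'v parity_game \<Rightarrow> (nat \<Rightarrow> 'v) \<Rightarrow> bool" where
  "play G p \<longleftrightarrow> infinite_path (moves G) p"

definition play_winner :: "'v parity_game \<Rightarrow> (nat \<Rightarrow> 'v) \<Rightarrow> nat" where
  "play_winner G p = Max {m. infinite {i. prio G (p i) = m}} mod 2"

text \<open>Partial functions are single-valued relations. Strategies choose moves of the game:
  otherwise a strategy prescribing a non-edge would admit no consistent play and win vacuously.\<close>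

definition strategy :: "'v parity_game \<Rightarrow> nat \<Rightarrow> ('v \<times> 'v) set \<Rightarrow> bool" where
  "strategy G \<alpha> \<sigma> \<longleftrightarrow>
     single_valued \<sigma> \<and> \<sigma> \<subseteq> moves G \<and> Domain \<sigma> \<subseteq> {v \<in> nodes G. owner G v = \<alpha>}"

definition consistent :: "('v \<times> 'v) set \<Rightarrow> (nat \<Rightarrow> 'v) \<Rightarrow> bool" where
  "consistent \<sigma> p \<longleftrightarrow> (\<forall>i. p i \<in> Domain \<sigma> \<longrightarrow> (p i, p (Suc i)) \<in> \<sigma>)"

definition wins_from :: "'v parity_game \<Rightarrow> nat \<Rightarrow> ('v \<times> 'v) set \<Rightarrow> 'v \<Rightarrow> bool" where
  "wins_from G \<alpha> \<sigma> v \<longleftrightarrow>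
     (\<forall>p. play G p \<and> p 0 = v \<and> consistent \<sigma> p \<longrightarrow> play_winner G p = \<alpha>)"

definition wins :: "'v parity_game \<Rightarrow> nat \<Rightarrow> 'v \<Rightarrow> bool" where
  "wins G \<alpha> v \<longleftrightarrow> (\<exists>\<sigma>. strategy G \<alpha> \<sigma> \<and> wins_from G \<alpha> \<sigma> v)"

text \<open>The equivalence expresses that \<open>W v\<close> is the unique player with such a strategy.\<close>

definition winning_function :: "'v parity_game \<Rightarrow> ('v \<Rightarrow> nat) \<Rightarrow> bool" where
  "winning_function G W \<longleftrightarrow>
     (\<forall>v\<in>nodes G. W v \<in> {0, 1} \<and> (\<forall>\<alpha>\<in>{0, 1}. wins G \<alpha> v \<longleftrightarrow> W v = \<alpha>))"

definition winning_strategy :: "'v parity_game \<Rightarrow> nat \<Rightarrow> ('v \<times> 'v) set \<Rightarrow> bool" where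
  "winning_strategy G \<alpha> \<sigma> \<longleftrightarrow>
     strategy G \<alpha> \<sigma> \<and> (\<forall>v\<in>nodes G. wins G \<alpha> v \<longrightarrow> wins_from G \<alpha> \<sigma> v)"


definition direct_justification ::
    "'v parity_game \<Rightarrow> nat \<Rightarrow> 'v \<Rightarrow> ('v \<times> 'v) set \<Rightarrow> bool" where
  "direct_justification G \<alpha> v dj \<longleftrightarrow>
     v \<in> nodes G \<and> \<alpha> \<in> {0, 1} \<and>
     (if owner G v = \<alpha> then \<exists>w. (v, w) \<in> moves G \<and> dj = {(v, w)}
      else dj = {e \<in> moves G. fst e = v})"

definition winning_dj ::
    "'v parity_game \<Rightarrow> ('v \<Rightarrow> nat) \<Rightarrow> nat \<Rightarrow> 'v \<Rightarrow> ('v \<times> 'v) set \<Rightarrow> bool" where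
  "winning_dj G H \<alpha> v dj \<longleftrightarrow> direct_justification G \<alpha> v dj \<and> (\<forall>(u, w)\<in>dj. H w = \<alpha>)"

text \<open>The node set of a justification is that of the game and is not stored.\<close>

record 'v justification =
  edges :: "('v \<times> 'v) set"
  hyp :: "'v \<Rightarrow> nat"

definition is_justification :: "'v parity_game \<Rightarrow> 'v justification \<Rightarrow> bool" where
  "is_justification G J \<longleftrightarrow> edges J \<subseteq> moves G \<and> (\<forall>v\<in>nodes G. hyp J v \<in> {0, 1})"

definition out_edges :: "'v justification \<Rightarrow> 'v \<Rightarrow> ('v \<times> 'v) set" where
  "out_edges J v = {e \<in> edges J. fst e = v}"

definition justified :: "'v parity_game \<Rightarrow> 'v justification \<Rightarrow> 'v set" where
  "justified G J = {v \<in> nodes G. out_edges J v \<noteq> {}}"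

definition unjustified :: "'v parity_game \<Rightarrow> 'v justification \<Rightarrow> 'v set" where
  "unjustified G J = {v \<in> nodes G. out_edges J v = {}}"

definition weakly_winning :: "'v parity_game \<Rightarrow> 'v justification \<Rightarrow> bool" where
  "weakly_winning G J \<longleftrightarrow>
     is_justification G J \<and>
     (\<forall>v\<in>justified G J. winning_dj G (hyp J) (hyp J v) v (out_edges J v))"

definition winning :: "'v parity_game \<Rightarrow> 'v justification \<Rightarrow> bool" where
  "winning G J \<longleftrightarrow>
     weakly_winning G J \<and>
     (\<forall>p. infinite_path (edges J) p \<longrightarrow> play_winner G p = hyp J (p 0))"

definition justification_strategy ::
    "'v parity_game \<Rightarrow> 'v justification \<Rightarrow> nat \<Rightarrow> ('v \<times> 'v) set" where
  "justification_strategy G J \<alpha> = {(v, w) \<in> edges J. owner G v = \<alpha> \<and> hyp J v = \<alpha>}"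

definition down :: "'v parity_game \<Rightarrow> 'v justification \<Rightarrow> 'v \<Rightarrow> 'v set" where
  "down G J v = {u \<in> nodes G. (u, v) \<in> (edges J)\<^sup>*}"

text \<open>The infimum of the empty set in \<^typ>\<open>enat\<close> is \<open>\<infinity>\<close>.\<close>

definition jl :: "'v parity_game \<Rightarrow> 'v justification \<Rightarrow> 'v \<Rightarrow> enat" where
  "jl G J v = (INF w\<in>{w \<in> unjustified G J. (v, w) \<in> (edges J)\<^sup>*}. enat (prio G w))"

definition jl_dj :: "'v parity_game \<Rightarrow> 'v justification \<Rightarrow> ('v \<times> 'v) set \<Rightarrow> enat" where
  "jl_dj G J dj = (INF e\<in>dj. jl G J (snd e))"

definition default_hyp :: "'v parity_game \<Rightarrow> 'v \<Rightarrow> nat" where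
  "default_hyp G v = prio G v mod 2"

definition safe :: "'v parity_game \<Rightarrow> 'v justification \<Rightarrow> bool" where
  "safe G J \<longleftrightarrow>
     winning G J \<and>
     (\<forall>v\<in>unjustified G J. hyp J v = default_hyp G v) \<and>
     (\<forall>v\<in>nodes G. jl G J v \<ge> enat (prio G v))"

definition set_dj ::
    "'v justification \<Rightarrow> 'v \<Rightarrow> ('v \<times> 'v) set \<Rightarrow> nat \<Rightarrow> 'v justification" where
  "set_dj J v dj \<alpha> =
     \<lparr>edges = {e \<in> edges J. fst e \<noteq> v} \<union> dj, hyp = (hyp J)(v := \<alpha>)\<rparr>"

definition reset :: "'v parity_game \<Rightarrow> 'v justification \<Rightarrow> 'v set \<Rightarrow> 'v justification" where
  "reset G J S =
     \<lparr>edges = {e \<in> edges J. fst e \<notin> S},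
      hyp = (\<lambda>w. if w \<in> S then default_hyp G w else hyp J w)\<rparr>"

definition executable ::
    "'v parity_game \<Rightarrow> 'v justification \<Rightarrow> 'v \<Rightarrow> ('v \<times> 'v) set \<Rightarrow> bool" where
  "executable G J v dj \<longleftrightarrow>
     safe G J \<and>
     (\<exists>\<alpha>\<in>{0, 1}. winning_dj G (hyp J) \<alpha> v dj) \<and>
     (v \<in> unjustified G J \<longrightarrow> jl_dj G J dj \<ge> jl G J v) \<and>
     (v \<in> justified G J \<longrightarrow> jl_dj G J dj > jl G J v)"

text \<open>The player is determined by \<open>dj\<close>, because a direct justification is nonempty
  and its edges lead to nodes with hypothesis \<open>\<alpha>\<close>.\<close>

lemma winning_dj_unique:
  assumes "parity_game G" "winning_dj G H \<alpha> v dj" "winning_dj G H \<beta> v dj"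
  shows "\<alpha> = \<beta>"
proof -
  have "dj \<noteq> {}"
    using assms(1,2)
    by (fastforce simp: parity_game_def winning_dj_def direct_justification_def split: if_splits)
  then show ?thesis
    using assms(2,3) by (fastforce simp: winning_dj_def)
qed

definition Justify ::
    "'v parity_game \<Rightarrow> 'v justification \<Rightarrow> 'v \<Rightarrow> ('v \<times> 'v) set \<Rightarrow> 'v justification" where
  "Justify G J v dj =
     (let \<alpha> = (THE \<alpha>. winning_dj G (hyp J) \<alpha> v dj)
      in if hyp J v = \<alpha> then set_dj J v dj \<alpha>
         else set_dj (reset G J (down G J v)) v dj \<alpha>)"

text \<open>A sequence \<open>Js 0, Js 1, \<dots>\<close> of \<open>N\<close> steps, where \<open>N = \<infinity>\<close> for an infinite sequence. A finite
  sequence may stop at \<open>Js k\<close> only if \<open>Js k\<close> has no unjustified node or if it is stuck, that is,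
  no operation is executable; that it never gets stuck is not presupposed.\<close>

definition justify_sequence ::
    "'v parity_game \<Rightarrow> 'v justification \<Rightarrow> enat \<Rightarrow> (nat \<Rightarrow> 'v justification) \<Rightarrow> bool" where
  "justify_sequence G J0 N Js \<longleftrightarrow>
     Js 0 = J0 \<and>
     (\<forall>i. enat i < N \<longrightarrow>
        (\<exists>v dj. executable G (Js i) v dj \<and> Js (Suc i) = Justify G (Js i) v dj)) \<and>
     (\<forall>k. N = enat k \<and> unjustified G (Js k) \<noteq> {} \<longrightarrow> (\<nexists>v dj. executable G (Js k) v dj))"

lemma safe_initial:
  assumes "parity_game G"
  shows "safe G \<lparr>edges = {}, hyp = default_hyp G\<rparr>"
  by (auto simp: safe_def winning_def weakly_winning_def is_justification_def justified_def
      out_edges_def infinite_path_def jl_def default_hyp_def unjustified_def intro: INF_greatest)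

end

theory Submission
  imports Defs
begin

text \<open>
  Each step preserves safety and increases the following bounded quantity, which gives termination:
  a justified node of level \<open>l\<close> contributes \<open>(|V| + 1) ^ l\<close>, with \<open>\<infinity>\<close> replaced by a number above all
  priorities, and an unjustified node contributes \<open>0\<close>. When the hypothesis of \<open>v\<close> is kept, no level
  decreases and the contribution of \<open>v\<close> grows. When it is flipped, the at most \<open>|V|\<close> nodes that lose
  their justification reach \<open>v\<close>, so their levels are at most that of \<open>v\<close>, while the new level of
  \<open>v\<close> is strictly larger. As long as some node is unjustified, one of least priority
  can be justified, so the sequence does not get stuck. Without unjustified nodes, the plays consistent
  with the strategy of a player are paths of the justification, which that player wins.
\<close>

section \<open>Plays\<close>

text \<open>Occurring infinitely often is \<open>frequently\<close> along
  \<open>sequentially\<close>, which dropping a prefix does not affect.\<close>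

lemma play_winner_shift: "play_winner G (\<lambda>i. p (i + k)) = play_winner G p"
proof -
  have "infinite {i. prio G (p (i + k)) = m} \<longleftrightarrow> infinite {i. prio G (p i) = m}" for m
  proof -
    have "frequently (\<lambda>i. prio G (p (i + k)) = m) sequentially
        \<longleftrightarrow> frequently (\<lambda>i. prio G (p i) = m) sequentially"
      unfolding frequently_def
      using eventually_sequentially_seg[of "\<lambda>i. prio G (p i) \<noteq> m" k] by simp
    then show ?thesis
      by (simp add: frequently_cofinite[symmetric] cofinite_eq_sequentially)
  qed
  then show ?thesis by (simp add: play_winner_def)
qed

text \<open>Decides plays that return to one node of maximal priority: that priority is then the
  largest one seen infinitely often.\<close>

lemma play_winner_dominating:
  assumes "\<And>i. prio G (p i) \<le> prio G v" "infinite {i. p i = v}"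
  shows "play_winner G p = prio G v mod 2"
proof -
  let ?M = "{m. infinite {i. prio G (p i) = m}}"
  have "m \<le> prio G v" if "m \<in> ?M" for m
    using assms(1) that not_finite_existsD by fastforce
  moreover have "prio G v \<in> ?M"
    using assms(2) by (auto elim!: contrapos_nn intro: finite_subset[rotated])
  ultimately have "Max ?M = prio G v"
    by (intro Max_eqI) (auto intro: finite_subset[of _ "{..prio G v}"])
  then show ?thesis by (simp add: play_winner_def)
qed

text \<open>The two strategies live on nodes of different owners, so one play can follow both, and
  it would have two winners.\<close>

lemma not_wins_both:
  assumes G: "parity_game G" and v: "v \<in> nodes G"
    and "wins G 0 v" "wins G 1 v"
  shows False
proof -
  obtain \<sigma> \<tau> where \<sigma>: "strategy G 0 \<sigma>" "wins_from G 0 \<sigma> v"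
    and \<tau>: "strategy G 1 \<tau>" "wins_from G 1 \<tau> v"
    using assms(3,4) by (auto simp: wins_def)
  have disj: "Domain \<sigma> \<inter> Domain \<tau> = {}"
    using \<sigma>(1) \<tau>(1) unfolding strategy_def by force
  \<comment> \<open>At each node at most one strategy prescribes a move; where neither does, any
    move will do.\<close>
  have "\<exists>w. (u, w) \<in> moves G \<and> (u \<in> Domain \<sigma> \<longrightarrow> (u, w) \<in> \<sigma>) \<and> (u \<in> Domain \<tau> \<longrightarrow> (u, w) \<in> \<tau>)"
    if "u \<in> nodes G" for u
  proof (cases "u \<in> Domain \<sigma> \<union> Domain \<tau>")
    case True
    then obtain w where "(u, w) \<in> \<sigma> \<or> (u, w) \<in> \<tau>" by blast
    then show ?thesis using disj \<sigma>(1) \<tau>(1) unfolding strategy_def by blast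
  next
    case False
    then show ?thesis using G that by (auto simp: parity_game_def)
  qed
  then obtain s where s: "\<And>u. u \<in> nodes G \<Longrightarrow> (u, s u) \<in> moves G \<and>
      (u \<in> Domain \<sigma> \<longrightarrow> (u, s u) \<in> \<sigma>) \<and> (u \<in> Domain \<tau> \<longrightarrow> (u, s u) \<in> \<tau>)"
    by metis
  define p where "p i = (s ^^ i) v" for i
  have p: "p i \<in> nodes G" for i
    using G s v by (induction i) (auto simp: p_def parity_game_def)
  then have "play G p" "consistent \<sigma> p" "consistent \<tau> p" "p 0 = v"
    using s by (auto simp: play_def infinite_path_def consistent_def p_def)
  then show False
    using \<sigma>(2) \<tau>(2) by (auto simp: wins_from_def)
qed

section \<open>Justification levels\<close>

lemma jl_le_prio:
  "\<lbrakk>x \<in> unjustified G J; (u, x) \<in> (edges J)\<^sup>*\<rbrakk> \<Longrightarrow> jl G J u \<le> enat (prio G x)"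
  by (auto simp: jl_def intro: INF_lower)

lemma le_jlI:
  "(\<And>x. x \<in> unjustified G J \<Longrightarrow> (u, x) \<in> (edges J)\<^sup>* \<Longrightarrow> l \<le> enat (prio G x)) \<Longrightarrow> l \<le> jl G J u"
  by (auto simp: jl_def intro: INF_greatest)

text \<open>Whatever \<open>w\<close> reaches, \<open>u\<close> reaches too, so the infimum for
  \<open>u\<close> ranges over a larger set.\<close>

lemma jl_mono_reach: "(u, w) \<in> (edges J)\<^sup>* \<Longrightarrow> jl G J u \<le> jl G J w"
  by (meson jl_le_prio le_jlI rtrancl_trans)

lemma jl_dj_le: "(v, w) \<in> dj \<Longrightarrow> jl_dj G J dj \<le> jl G J w"
  unfolding jl_dj_def by (force intro: INF_lower2)

text \<open>A finite infimum in \<open>enat\<close> comes from a nonempty set and is attained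
  because \<open>enat\<close> is well-ordered.\<close>

lemma jl_attained:
  assumes "jl G J u < \<infinity>"
  obtains x where "x \<in> unjustified G J" "(u, x) \<in> (edges J)\<^sup>*" "jl G J u = enat (prio G x)"
proof -
  let ?A = "(\<lambda>w. enat (prio G w)) ` {w \<in> unjustified G J. (u, w) \<in> (edges J)\<^sup>*}"
  have "Inf ?A \<noteq> \<infinity>"
    using assms by (simp add: jl_def)
  then have "?A \<noteq> {}"
    by (metis Inf_enat_def)
  then obtain a where "a \<in> ?A" by blast
  then have "Inf ?A \<in> ?A"
    by (rule wellorder_InfI)
  then show thesis
    using that by (auto simp: jl_def)
qed

lemma unjustified_no_edge: "v \<in> unjustified G J \<Longrightarrow> (v, w) \<notin> edges J"
  by (auto simp: unjustified_def out_edges_def)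

lemma jl_unjustified:
  assumes "v \<in> unjustified G J"
  shows "jl G J v = enat (prio G v)"
proof -
  have "x = v" if "(v, x) \<in> (edges J)\<^sup>*" for x
    using that by cases (use assms unjustified_no_edge in \<open>metis converse_rtranclE that\<close>)+
  then show ?thesis
    by (metis antisym assms jl_le_prio le_jlI order_refl rtrancl.rtrancl_refl)
qed

section \<open>Safety is preserved\<close>

text \<open>The tail of an edge is justified, and its outgoing edges win it for its own hypothesis.
  Hence hypotheses are constant along paths.\<close>

lemma weakly_winning_hyp_edge:
  assumes "parity_game G" "weakly_winning G J" "(u, w) \<in> edges J"
  shows "hyp J w = hyp J u"
proof -
  have "u \<in> justified G J"
    using assms by (auto simp: justified_def out_edges_def weakly_winning_def is_justification_def
        parity_game_def)
  then show ?thesis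
    using assms(2,3) by (fastforce simp: weakly_winning_def winning_dj_def out_edges_def)
qed

lemma weakly_winning_hyp_reach:
  assumes "parity_game G" "weakly_winning G J" "(u, w) \<in> (edges J)\<^sup>*"
  shows "hyp J w = hyp J u"
  using assms(3) by induction (use assms weakly_winning_hyp_edge in metis)+

lemma winning_djD:
  assumes "winning_dj G H \<alpha> v dj"
  shows "v \<in> nodes G" "\<alpha> \<in> {0, 1}" "dj \<subseteq> moves G" "\<And>e. e \<in> dj \<Longrightarrow> fst e = v"
    "\<And>u w. (u, w) \<in> dj \<Longrightarrow> H w = \<alpha>"
  using assms by (auto simp: winning_dj_def direct_justification_def split: if_splits)

lemma winning_dj_nonempty:
  assumes "parity_game G" "winning_dj G H \<alpha> v dj"
  shows "dj \<noteq> {}"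
  using assms
  by (fastforce simp: parity_game_def winning_dj_def direct_justification_def split: if_splits)

lemma winning_dj_cong:
  assumes "winning_dj G H \<alpha> v dj" "\<And>u w. (u, w) \<in> dj \<Longrightarrow> H' w = H w"
  shows "winning_dj G H' \<alpha> v dj"
  using assms by (fastforce simp: winning_dj_def)

lemma Justify_eq:
  assumes "parity_game G" "winning_dj G (hyp J) \<alpha> v dj"
  shows "Justify G J v dj =
    (if hyp J v = \<alpha> then set_dj J v dj \<alpha> else set_dj (reset G J (down G J v)) v dj \<alpha>)"
proof -
  have "(THE \<alpha>. winning_dj G (hyp J) \<alpha> v dj) = \<alpha>"
    using assms(2) winning_dj_unique[OF assms(1) _ assms(2)] by (rule the_equality)
  then show ?thesis by (simp add: Justify_def)
qed

text \<open>Cut the path at its first and last visits to \<open>v\<close>: the pieces before and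
  after use only edges of \<open>R\<close> that do not leave \<open>v\<close>.\<close>

lemma rtrancl_replace_out:
  assumes "(u, x) \<in> ({e \<in> R. fst e \<noteq> v} \<union> dj)\<^sup>*" "\<And>e. e \<in> dj \<Longrightarrow> fst e = v"
  shows "(u, x) \<in> {e \<in> R. fst e \<noteq> v}\<^sup>* \<or>
    ((u, v) \<in> {e \<in> R. fst e \<noteq> v}\<^sup>* \<and> (\<exists>w. (v, w) \<in> dj \<and> (w, x) \<in> {e \<in> R. fst e \<noteq> v}\<^sup>*))"
  using assms(1)
proof (induction rule: converse_rtrancl_induct)
  case (step u y)
  show ?case
  proof (cases "u = v")
    case True
    then show ?thesis using step by auto
  next
    case False
    then have "(u, y) \<in> {e \<in> R. fst e \<noteq> v}" using step(1) assms(2) by fastforce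
    then show ?thesis using step.IH by (meson converse_rtrancl_into_rtrancl)
  qed
qed auto

lemma rtrancl_out_removed: "(v, x) \<in> {e \<in> R. fst e \<noteq> v}\<^sup>* \<Longrightarrow> x = v"
  by (erule converse_rtranclE) auto

lemma infinite_path_rtrancl:
  assumes "infinite_path R p"
  shows "(p i, p (i + n)) \<in> R\<^sup>*"
  using assms by (induction n) (auto simp: infinite_path_def intro: rtrancl_into_rtrancl)

text \<open>The winning player is a parameter here, so that the description operator in
  \<open>Justify\<close> is met only in \<open>Justify_eq\<close>.\<close>

locale justify_step =
  fixes G :: "'v parity_game" and J :: "'v justification"
    and v :: 'v and dj :: "('v \<times> 'v) set" and \<alpha> :: nat
  assumes G: "parity_game G"
    and exec: "executable G J v dj"
    and dj: "winning_dj G (hyp J) \<alpha> v dj"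
begin

lemma safeJ: "safe G J"
  using exec by (simp add: executable_def)

lemma wwJ: "weakly_winning G J"
  using safeJ by (simp add: safe_def winning_def)

lemma winning_path: "infinite_path (edges J) p \<Longrightarrow> play_winner G p = hyp J (p 0)"
  using safeJ by (simp add: safe_def winning_def)

lemma unjustified_default: "x \<in> unjustified G J \<Longrightarrow> hyp J x = default_hyp G x"
  using safeJ by (simp add: safe_def)

lemma prio_le_jl: "u \<in> nodes G \<Longrightarrow> enat (prio G u) \<le> jl G J u"
  using safeJ by (simp add: safe_def)

lemma edge_nodes: "(u, w) \<in> edges J \<Longrightarrow> u \<in> nodes G \<and> w \<in> nodes G"
  using wwJ G by (auto simp: weakly_winning_def is_justification_def parity_game_def)

lemma justified_cases: "v \<in> justified G J \<or> v \<in> unjustified G J"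
  using winning_djD(1)[OF dj] by (auto simp: justified_def unjustified_def)

lemma jl_v_le_dj: "jl G J v \<le> jl_dj G J dj"
  using exec justified_cases by (auto simp: executable_def)

lemma jl_v_less_dj_justified: "v \<in> justified G J \<Longrightarrow> jl G J v < jl_dj G J dj"
  using exec by (auto simp: executable_def)

section \<open>Justifying a node without changing its hypothesis\<close>

abbreviation "keep \<equiv> set_dj J v dj \<alpha>"

lemma edges_keep: "edges keep = {e \<in> edges J. fst e \<noteq> v} \<union> dj"
  by (simp add: set_dj_def)

lemma out_edges_keep: "out_edges keep u = (if u = v then dj else out_edges J u)"
  using winning_djD(4)[OF dj] by (auto simp: out_edges_def edges_keep)

lemma unjustified_keep: "unjustified G keep = unjustified G J - {v}"
  using winning_dj_nonempty[OF G dj] by (auto simp: unjustified_def out_edges_keep)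

text \<open>Newly reachable nodes are reached through \<open>v\<close> and then \<open>dj\<close>,
  whose level is at least that of \<open>v\<close>, a node that \<open>u\<close> already
  reached.\<close>

lemma jl_keep_mono: "jl G J u \<le> jl G keep u"
proof (rule le_jlI)
  fix x assume x: "x \<in> unjustified G keep" "(u, x) \<in> (edges keep)\<^sup>*"
  have R0: "{e \<in> edges J. fst e \<noteq> v}\<^sup>* \<subseteq> (edges J)\<^sup>*"
    by (rule rtrancl_mono) auto
  consider "(u, x) \<in> (edges J)\<^sup>*" |
    w where "(u, v) \<in> (edges J)\<^sup>*" "(v, w) \<in> dj" "(w, x) \<in> (edges J)\<^sup>*"
    using rtrancl_replace_out[OF x(2)[unfolded edges_keep] winning_djD(4)[OF dj]] R0 by blast
  then show "jl G J u \<le> enat (prio G x)"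
  proof cases
    case 1
    then show ?thesis using x(1) by (simp add: jl_le_prio unjustified_keep)
  next
    case 2
    have "jl G J u \<le> jl G J v" by (rule jl_mono_reach[OF 2(1)])
    also note jl_v_le_dj
    also have "jl_dj G J dj \<le> jl G J w" by (rule jl_dj_le[OF 2(2)])
    also have "\<dots> \<le> enat (prio G x)"
      using x(1) 2(3) by (simp add: jl_le_prio unjustified_keep)
    finally show ?thesis .
  qed
qed

text \<open>Since \<open>v\<close> is now justified, an unjustified node reached from it lies beyond
  its last visit, hence beyond some edge of \<open>dj\<close> along old edges.\<close>

lemma jl_keep_v: "jl_dj G J dj \<le> jl G keep v"
proof (rule le_jlI)
  fix x assume x: "x \<in> unjustified G keep" "(v, x) \<in> (edges keep)\<^sup>*"
  have R0: "{e \<in> edges J. fst e \<noteq> v}\<^sup>* \<subseteq> (edges J)\<^sup>*"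
    by (rule rtrancl_mono) auto
  have "x \<noteq> v" using x(1) by (simp add: unjustified_keep)
  then have "(v, x) \<notin> {e \<in> edges J. fst e \<noteq> v}\<^sup>*"
    using rtrancl_out_removed by metis
  then obtain w where w: "(v, w) \<in> dj" "(w, x) \<in> (edges J)\<^sup>*"
    using rtrancl_replace_out[OF x(2)[unfolded edges_keep] winning_djD(4)[OF dj]] R0 by blast
  have "jl_dj G J dj \<le> jl G J w" by (rule jl_dj_le[OF w(1)])
  also have "\<dots> \<le> enat (prio G x)"
    using x(1) w(2) by (simp add: jl_le_prio unjustified_keep)
  finally show "jl_dj G J dj \<le> enat (prio G x)" .
qed

lemma weakly_winning_keep:
  assumes "hyp J v = \<alpha>"
  shows "weakly_winning G keep"
proof -
  have [simp]: "hyp keep = hyp J"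
    using assms by (auto simp: set_dj_def)
  have "is_justification G keep"
    using wwJ winning_djD(3)[OF dj]
    by (auto simp: weakly_winning_def is_justification_def edges_keep)
  moreover have "winning_dj G (hyp J) (hyp J u) u (out_edges keep u)" if "u \<in> justified G keep" for u
    using that wwJ dj assms
    by (cases "u = v") (auto simp: out_edges_keep weakly_winning_def justified_def)
  ultimately show ?thesis by (simp add: weakly_winning_def)
qed

text \<open>A path of \<open>keep\<close> through \<open>v\<close> infinitely often closes cycles through \<open>v\<close>. If \<open>v\<close> was justified,
  the strict increase of the level rules this out; if it was unjustified, \<open>v\<close> has the highest
  priority on each such cycle, and this priority has the parity of \<open>\<alpha>\<close>.\<close>

lemma safe_keep:
  assumes \<alpha>: "hyp J v = \<alpha>"
  shows "safe G keep"
proof -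
  have [simp]: "hyp keep = hyp J"
    using assms by (auto simp: set_dj_def)
  note ww = weakly_winning_keep[OF \<alpha>]
  have "play_winner G p = hyp J (p 0)" if p: "infinite_path (edges keep) p" for p
  proof (cases "finite {i. p i = v}")
    \<comment> \<open>After the last visit to \<open>v\<close> the path runs in \<open>J\<close>,
      which decides its winner; the hypothesis at that point equals the initial one.\<close>
    case True
    then obtain k where k: "\<And>i. p i = v \<Longrightarrow> i < k"
      by (auto simp: finite_nat_set_iff_bounded)
    have "infinite_path (edges J) (\<lambda>i. p (i + k))"
      unfolding infinite_path_def
    proof
      fix i
      have "p (i + k) \<noteq> v" using k[of "i + k"] by auto
      then show "(p (i + k), p (Suc i + k)) \<in> edges J"
        using p winning_djD(4)[OF dj] by (fastforce simp: infinite_path_def edges_keep)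
    qed
    from winning_path[OF this] have "play_winner G p = hyp J (p k)"
      by (simp add: play_winner_shift)
    also have "\<dots> = hyp J (p 0)"
      using weakly_winning_hyp_reach[OF G ww] infinite_path_rtrancl[OF p, of 0 k] by simp
    finally show ?thesis .
  next
    case False
    have R0: "{e \<in> edges J. fst e \<noteq> v}\<^sup>* \<subseteq> (edges J)\<^sup>*"
      by (rule rtrancl_mono) auto
    \<comment> \<open>Up to its next visit to \<open>v\<close> the path uses old edges only, so
      \<open>v\<close> is reachable in \<open>J\<close> itself.\<close>
    have ret: "(p i, v) \<in> (edges keep)\<^sup>* \<and> (p i, v) \<in> (edges J)\<^sup>*" for i
    proof -
      obtain j where "j \<ge> i" "p j = v"
        using False by (auto simp: infinite_nat_iff_unbounded_le)
      then have r: "(p i, v) \<in> (edges keep)\<^sup>*"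
        using infinite_path_rtrancl[OF p, of i "j - i"] by simp
      then show ?thesis
        using rtrancl_replace_out[OF r[unfolded edges_keep] winning_djD(4)[OF dj]] R0 by blast
    qed
    obtain i where i: "p i = v" using False not_finite_existsD by auto
    have "(v, p (Suc i)) \<in> dj"
      using p[unfolded infinite_path_def edges_keep, rule_format, of i] i by auto
    then have "jl_dj G J dj \<le> jl G J v"
      using jl_dj_le jl_mono_reach ret order_trans by metis
    then have v: "v \<in> unjustified G J"
      using jl_v_less_dj_justified justified_cases by fastforce
    have "prio G (p i) \<le> prio G v" for i
    proof -
      have "p i \<in> nodes G"
        using p ww G by (fastforce simp: weakly_winning_def is_justification_def infinite_path_def
            parity_game_def)
      then have "enat (prio G (p i)) \<le> enat (prio G v)"
        using prio_le_jl jl_le_prio[OF v] ret order_trans by metis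
      then show ?thesis by simp
    qed
    then have "play_winner G p = default_hyp G v"
      using play_winner_dominating False by (metis default_hyp_def)
    also have "\<dots> = hyp J (p 0)"
      using unjustified_default[OF v] weakly_winning_hyp_reach[OF G wwJ] ret by metis
    finally show ?thesis .
  qed
  then show ?thesis
    using ww unjustified_default prio_le_jl jl_keep_mono order_trans
    by (fastforce simp: safe_def winning_def unjustified_keep)
qed

section \<open>Flipping the hypothesis of a node\<close>

abbreviation "S \<equiv> down G J v"
abbreviation "flip \<equiv> set_dj (reset G J S) v dj \<alpha>"

lemma v_in_S: "v \<in> S"
  using winning_djD(1)[OF dj] by (simp add: down_def)

lemma S_closed: "(u, w) \<in> edges J \<Longrightarrow> w \<in> S \<Longrightarrow> u \<in> S"
  using edge_nodes by (auto simp: down_def intro: converse_rtrancl_into_rtrancl)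

lemma edges_flip: "edges flip = {e \<in> edges J. fst e \<notin> S} \<union> dj"
  using v_in_S by (auto simp: set_dj_def reset_def)

lemma out_edges_flip:
  "out_edges flip u = (if u = v then dj else if u \<in> S then {} else out_edges J u)"
  using winning_djD(4)[OF dj] v_in_S by (auto simp: out_edges_def edges_flip)

lemma unjustified_flip: "unjustified G flip = (unjustified G J \<union> S) - {v}"
proof -
  have "S \<subseteq> nodes G" by (auto simp: down_def)
  then show ?thesis
    using winning_dj_nonempty[OF G dj] by (auto simp: unjustified_def out_edges_flip)
qed

lemma hyp_flip:
  "hyp flip u = (if u = v then \<alpha> else if u \<in> S then default_hyp G u else hyp J u)"
  by (simp add: set_dj_def reset_def)

context
  assumes \<alpha>: "hyp J v \<noteq> \<alpha>"
begin

text \<open>Nodes of \<open>S\<close> share the hypothesis of \<open>v\<close>, whereas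
  \<open>dj\<close> leads to nodes with hypothesis \<alpha>.\<close>

lemma dj_outside_S: "(u, w) \<in> dj \<Longrightarrow> w \<notin> S"
  using winning_djD(5)[OF dj] \<alpha> weakly_winning_hyp_reach[OF G wwJ] by (fastforce simp: down_def)

text \<open>No edge of \<open>flip\<close> enters \<open>S\<close>: the surviving old edges start
  outside this predecessor-closed set. So paths are outside \<open>S\<close> after one step.\<close>

lemma flip_edge_outside_S: "(u, w) \<in> edges flip \<Longrightarrow> w \<notin> S"
  using dj_outside_S S_closed by (auto simp: edges_flip)

lemma flip_edge_from_outside: "(u, w) \<in> edges flip \<Longrightarrow> u \<notin> S \<Longrightarrow> (u, w) \<in> edges J"
  using v_in_S winning_djD(4)[OF dj] by (fastforce simp: edges_flip)

lemma reach_flip_outside: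
  assumes "(u, x) \<in> (edges flip)\<^sup>*" "u \<notin> S"
  shows "(u, x) \<in> (edges J)\<^sup>* \<and> x \<notin> S"
  using assms
  by induction (auto dest: flip_edge_outside_S flip_edge_from_outside intro: rtrancl_into_rtrancl)

text \<open>Hypotheses change only inside \<open>S\<close>, where no edge of \<open>flip\<close>
  ends, so every direct justification in use stays winning.\<close>

lemma weakly_winning_flip: "weakly_winning G flip"
proof -
  have "is_justification G flip"
    using wwJ winning_djD(2,3)[OF dj]
    by (auto simp: weakly_winning_def is_justification_def edges_flip hyp_flip default_hyp_def)
  moreover have "winning_dj G (hyp flip) (hyp flip u) u (out_edges flip u)"
    if u: "u \<in> justified G flip" for u
  proof (cases "u = v")
    case True
    have "winning_dj G (hyp flip) \<alpha> v dj"
      using dj_outside_S v_in_S by (intro winning_dj_cong[OF dj]) (auto simp: hyp_flip)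
    then show ?thesis using True by (simp add: out_edges_flip hyp_flip)
  next
    case False
    then have uS: "u \<notin> S" and "u \<in> justified G J"
      using u by (auto simp: justified_def out_edges_flip split: if_splits)
    then have "winning_dj G (hyp J) (hyp J u) u (out_edges J u)"
      using wwJ by (simp add: weakly_winning_def)
    then have "winning_dj G (hyp flip) (hyp J u) u (out_edges J u)"
    proof (rule winning_dj_cong)
      fix a w assume "(a, w) \<in> out_edges J u"
      then have "w \<notin> S" using uS S_closed by (auto simp: out_edges_def)
      then show "hyp flip w = hyp J w" using v_in_S by (auto simp: hyp_flip)
    qed
    then show ?thesis using False uS by (simp add: out_edges_flip hyp_flip)
  qed
  ultimately show ?thesis by (simp add: weakly_winning_def)
qed

text \<open>Resetting creates unjustified nodes only in \<open>S\<close>, which is unreachable from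
  outside.\<close>

lemma jl_flip_outside: "u \<notin> S \<Longrightarrow> jl G J u \<le> jl G flip u"
  by (rule le_jlI) (auto dest!: reach_flip_outside simp: unjustified_flip intro: jl_le_prio)

lemma jl_flip_v: "jl_dj G J dj \<le> jl G flip v"
proof (rule le_jlI)
  fix x assume x: "x \<in> unjustified G flip" "(v, x) \<in> (edges flip)\<^sup>*"
  \<comment> \<open>The path is not empty, because \<open>v\<close> is justified in
    \<open>flip\<close> while \<open>x\<close> is not.\<close>
  then obtain w where w: "(v, w) \<in> edges flip" "(w, x) \<in> (edges flip)\<^sup>*"
    by (metis DiffE converse_rtranclE insertCI unjustified_flip)
  have "(v, w) \<in> dj" using w(1) v_in_S by (auto simp: edges_flip)
  then have "jl_dj G J dj \<le> jl G J w" by (rule jl_dj_le)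
  also have "\<dots> \<le> jl G flip w"
    using flip_edge_outside_S[OF w(1)] by (rule jl_flip_outside)
  also have "\<dots> \<le> enat (prio G x)" using x(1) w(2) by (rule jl_le_prio)
  finally show "jl_dj G J dj \<le> enat (prio G x)" .
qed

text \<open>From its second node on, every infinite path of \<open>flip\<close> is a path of
  \<open>J\<close> outside \<open>S\<close>, where the two hypotheses agree.\<close>

lemma safe_flip: "safe G flip"
proof -
  have "play_winner G p = hyp flip (p 0)" if p: "infinite_path (edges flip) p" for p
  proof -
    have outside: "p (Suc i) \<notin> S" for i
      using p flip_edge_outside_S by (auto simp: infinite_path_def)
    then have "infinite_path (edges J) (\<lambda>i. p (i + 1))"
      using p flip_edge_from_outside by (auto simp: infinite_path_def)
    from winning_path[OF this] have "play_winner G p = hyp J (p 1)"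
      unfolding play_winner_shift by simp
    also have "\<dots> = hyp flip (p 1)"
      using outside[of 0] v_in_S by (auto simp: hyp_flip)
    also have "\<dots> = hyp flip (p 0)"
      using p weakly_winning_hyp_edge[OF G weakly_winning_flip] by (simp add: infinite_path_def)
    finally show ?thesis .
  qed
  moreover have "enat (prio G u) \<le> jl G flip u" if u: "u \<in> nodes G" for u
  proof -
    consider "u = v" | "u \<noteq> v" "u \<in> S" | "u \<notin> S" by blast
    then show ?thesis
    proof cases
      case 1
      then show ?thesis using prio_le_jl[OF u] jl_v_le_dj jl_flip_v by (metis order_trans)
    next
      \<comment> \<open>Such a node has been reset, so its level is its own priority.\<close>
      case 2
      then show ?thesis by (simp add: jl_unjustified unjustified_flip)
    next
      case 3
      then show ?thesis using prio_le_jl[OF u] jl_flip_outside order_trans by metis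
    qed
  qed
  moreover have "hyp flip u = default_hyp G u" if "u \<in> unjustified G flip" for u
    using that unjustified_default by (auto simp: unjustified_flip hyp_flip)
  ultimately show ?thesis
    using weakly_winning_flip by (auto simp: safe_def winning_def)
qed

text \<open>If \<open>v\<close> is unjustified and both levels equal its priority, then an unjustified node reachable
  through \<open>dj\<close> has the priority, hence the default hypothesis, of \<open>v\<close>; but its hypothesis is \<open>\<alpha>\<close>.\<close>

lemma jl_v_less_dj_flip: "jl G J v < jl_dj G J dj"
proof (cases "v \<in> justified G J")
  case True
  then show ?thesis by (rule jl_v_less_dj_justified)
next
  case False
  then have v: "v \<in> unjustified G J" using justified_cases by simp
  show ?thesis
  proof (rule ccontr)
    assume "\<not> ?thesis"
    then have eq: "jl_dj G J dj = enat (prio G v)"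
      using jl_v_le_dj jl_unjustified[OF v] by simp
    obtain e where "e \<in> dj" using winning_dj_nonempty[OF G dj] by blast
    then have "jl_dj G J dj \<in> (\<lambda>e. jl G J (snd e)) ` dj"
      unfolding jl_dj_def by (blast intro: wellorder_InfI)
    then obtain u w where w: "(u, w) \<in> dj" "jl G J w = enat (prio G v)"
      using eq by auto
    then obtain x where x: "x \<in> unjustified G J" "(w, x) \<in> (edges J)\<^sup>*"
      "jl G J w = enat (prio G x)"
      using jl_attained[of G J w] by auto
    have "hyp J v = hyp J x"
      using unjustified_default x(1,3) v w(2) by (simp add: default_hyp_def)
    also have "\<dots> = \<alpha>"
      using weakly_winning_hyp_reach[OF G wwJ x(2)] winning_djD(5)[OF dj w(1)] by simp
    finally show False using \<alpha> by simp
  qed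
qed

end

end

lemma executable_justify_step:
  assumes "parity_game G" "executable G J v dj"
  obtains \<alpha> where "justify_step G J v dj \<alpha>"
  using assms by (auto simp: executable_def justify_step_def)

lemma safe_Justify:
  assumes "parity_game G" "executable G J v dj"
  shows "safe G (Justify G J v dj)"
proof -
  obtain \<alpha> where "justify_step G J v dj \<alpha>"
    using executable_justify_step[OF assms] .
  then interpret justify_step G J v dj \<alpha> .
  show ?thesis
    using Justify_eq[OF G dj] safe_keep safe_flip by simp
qed

section \<open>Termination\<close>

text \<open>Finite levels of justifications are priorities of nodes and lie below the cap;
  \<open>min\<close> makes the weight monotone and bounded on all of \<open>enat\<close>.\<close>

definition level_weight :: "'v parity_game \<Rightarrow> enat \<Rightarrow> nat" where
  "level_weight G l = Suc (card (nodes G)) ^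
     (case l of enat m \<Rightarrow> min m (Suc (Max (prio G ` nodes G))) | \<infinity> \<Rightarrow> Suc (Max (prio G ` nodes G)))"

definition node_weight :: "'v parity_game \<Rightarrow> 'v justification \<Rightarrow> 'v \<Rightarrow> nat" where
  "node_weight G J u = (if u \<in> justified G J then level_weight G (jl G J u) else 0)"

lemma level_weight_pos: "0 < level_weight G l"
  by (simp add: level_weight_def)

lemma level_weight_mono: "l \<le> l' \<Longrightarrow> level_weight G l \<le> level_weight G l'"
  unfolding level_weight_def by (intro power_increasing) (auto split: enat.splits)

lemma level_weight_le: "level_weight G l \<le> level_weight G \<infinity>"
  by (simp add: level_weight_mono)

text \<open>The smaller level is finite, hence a priority below the cap, so the exponent grows by at
  least one. The gained factor exceeds the number of nodes.\<close>

lemma level_weight_less: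
  assumes "parity_game G" "jl G J v < l"
  shows "Suc (card (nodes G)) * level_weight G (jl G J v) \<le> level_weight G l"
proof -
  have "jl G J v < \<infinity>" using assms(2) by (metis enat_ord_simps(4) enat_ord_simps(6) less_infinityE)
  then obtain x where x: "x \<in> unjustified G J" "jl G J v = enat (prio G x)"
    by (rule jl_attained)
  then have le: "prio G x \<le> Max (prio G ` nodes G)"
    using assms(1) by (auto simp: parity_game_def unjustified_def)
  have "Suc (card (nodes G)) * level_weight G (jl G J v) = Suc (card (nodes G)) ^ Suc (prio G x)"
    using le x(2) by (simp add: level_weight_def min_def)
  also have "\<dots> \<le> level_weight G l"
    unfolding level_weight_def using le assms(2) x(2)
    by (intro power_increasing) (auto split: enat.splits)
  finally show ?thesis .
qed

lemma sum_node_weight_less: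
  assumes "parity_game G" "executable G J v dj"
  shows "sum (node_weight G J) (nodes G) < sum (node_weight G (Justify G J v dj)) (nodes G)"
proof -
  obtain \<alpha> where "justify_step G J v dj \<alpha>"
    using executable_justify_step[OF assms] .
  then interpret justify_step G J v dj \<alpha> .
  have fin: "finite (nodes G)" using G by (simp add: parity_game_def)
  have vn: "v \<in> nodes G" by (rule winning_djD(1)[OF dj])
  show ?thesis
  proof (cases "hyp J v = \<alpha>")
    case True
    have J': "Justify G J v dj = keep" using Justify_eq[OF G dj] True by simp
    have vj: "v \<in> justified G keep"
      using vn unjustified_keep by (auto simp: justified_def unjustified_def)
    have "node_weight G J v < node_weight G keep v"
    proof (cases "v \<in> justified G J")
      case v: True
      \<comment> \<open>The node set contains \<open>v\<close>, so the base is at least 2.\<close>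
      have "level_weight G (jl G J v) < Suc (card (nodes G)) * level_weight G (jl G J v)"
        using level_weight_pos[of G] vn fin by (auto simp: card_gt_0_iff)
      also have "\<dots> \<le> level_weight G (jl G keep v)"
        using jl_v_less_dj_justified[OF v] jl_keep_v by (intro level_weight_less[OF G]) simp
      finally show ?thesis using v vj by (simp add: node_weight_def)
    next
      case False
      then show ?thesis using vj by (simp add: node_weight_def level_weight_pos)
    qed
    moreover have "node_weight G J u \<le> node_weight G keep u" for u
      using unjustified_keep level_weight_mono[OF jl_keep_mono]
      by (auto simp: node_weight_def justified_def unjustified_def)
    ultimately show ?thesis
      unfolding J' using fin vn by (intro sum_strict_mono_ex1) auto
  next
    case \<alpha>: False
    have J': "Justify G J v dj = flip" using Justify_eq[OF G dj] \<alpha> by simp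
    have SV: "S \<subseteq> nodes G" by (auto simp: down_def)
    then have finS: "finite S" using fin finite_subset by blast
    have "node_weight G J u \<le> level_weight G (jl G J v)" if "u \<in> S" for u
      using that jl_mono_reach[of u v J G]
      by (auto simp: node_weight_def down_def intro: level_weight_mono)
    then have "sum (node_weight G J) S \<le> card S * level_weight G (jl G J v)"
      using sum_bounded_above[of S "node_weight G J"] by simp
    also have "\<dots> \<le> card (nodes G) * level_weight G (jl G J v)"
      using card_mono[OF fin SV] by simp
    also have "\<dots> < Suc (card (nodes G)) * level_weight G (jl G J v)"
      using level_weight_pos by simp
    also have "\<dots> \<le> level_weight G (jl G flip v)"
      using jl_v_less_dj_flip[OF \<alpha>] jl_flip_v[OF \<alpha>] by (intro level_weight_less[OF G]) simp
    also have "\<dots> = node_weight G flip v"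
      using vn unjustified_flip by (auto simp: node_weight_def justified_def unjustified_def)
    also have "\<dots> \<le> sum (node_weight G flip) S"
      using v_in_S finS by (intro member_le_sum) auto
    finally have inside: "sum (node_weight G J) S < sum (node_weight G flip) S" .
    \<comment> \<open>Outside \<open>S\<close> the outgoing edges are unchanged and no level
      drops.\<close>
    have "node_weight G J u \<le> node_weight G flip u" if "u \<notin> S" for u
      using that v_in_S level_weight_mono[OF jl_flip_outside[OF \<alpha>]]
      by (auto simp: node_weight_def justified_def out_edges_flip)
    then have "sum (node_weight G J) (nodes G - S) \<le> sum (node_weight G flip) (nodes G - S)"
      by (intro sum_mono) simp
    then show ?thesis
      unfolding J' using inside sum.subset_diff[OF SV fin, of "node_weight G J"]
        sum.subset_diff[OF SV fin, of "node_weight G flip"] by linarith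
  qed
qed

lemma sum_node_weight_le:
  "sum (node_weight G J) (nodes G) \<le> card (nodes G) * level_weight G \<infinity>"
  using sum_bounded_above[of "nodes G" "node_weight G J" "level_weight G \<infinity>"]
  by (simp add: node_weight_def level_weight_le)

section \<open>Progress\<close>

text \<open>Either the owner has a move to a node with his hypothesis, or all successors carry the
  opponent's, and then all moves together justify \<open>v\<close> for the opponent.\<close>

lemma exists_winning_dj:
  assumes G: "parity_game G" and J: "is_justification G J" and v: "v \<in> nodes G"
  shows "\<exists>\<alpha>\<in>{0, 1}. \<exists>dj. winning_dj G (hyp J) \<alpha> v dj"
proof -
  have own: "owner G v \<in> {0, 1}" using G v by (simp add: parity_game_def)
  show ?thesis
  proof (cases "\<exists>w. (v, w) \<in> moves G \<and> hyp J w = owner G v")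
    case True
    then obtain w where "(v, w) \<in> moves G" "hyp J w = owner G v" by blast
    then have "winning_dj G (hyp J) (owner G v) v {(v, w)}"
      using v own by (simp add: winning_dj_def direct_justification_def)
    then show ?thesis using own by (intro bexI exI)
  next
    case False
    have "hyp J w = 1 - owner G v" if "(v, w) \<in> moves G" for w
    proof -
      have "w \<in> nodes G" using that G by (auto simp: parity_game_def)
      then have "hyp J w \<in> {0, 1}" using J by (simp add: is_justification_def)
      moreover have "hyp J w \<noteq> owner G v" using False that by blast
      ultimately show ?thesis using own by auto
    qed
    then have "winning_dj G (hyp J) (1 - owner G v) v {e \<in> moves G. fst e = v}"
      using v own by (auto simp: winning_dj_def direct_justification_def)
    moreover have "1 - owner G v \<in> {0, 1}" by auto
    ultimately show ?thesis by (intro bexI exI)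
  qed
qed

text \<open>For an unjustified \<open>v\<close> of least priority, the level of \<open>v\<close> is
  its priority, a lower bound for all levels; so any winning direct justification of
  \<open>v\<close> is executable.\<close>

lemma exists_executable:
  assumes G: "parity_game G" and J: "safe G J" and U: "unjustified G J \<noteq> {}"
  shows "\<exists>v dj. executable G J v dj"
proof -
  obtain u where "u \<in> unjustified G J" using U by blast
  then obtain v where v: "v \<in> unjustified G J"
    and least: "\<And>x. x \<in> unjustified G J \<Longrightarrow> prio G v \<le> prio G x"
    using ex_has_least_nat[of "\<lambda>x. x \<in> unjustified G J" u "prio G"] by blast
  obtain \<alpha> dj where dj: "\<alpha> \<in> {0, 1}" "winning_dj G (hyp J) \<alpha> v dj"
    using exists_winning_dj[OF G, of J v] J v
    by (fastforce simp: safe_def winning_def weakly_winning_def unjustified_def)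
  have "enat (prio G v) \<le> jl G J w" for w
    using least by (intro le_jlI) simp
  then have "jl G J v \<le> jl_dj G J dj"
    by (auto simp: jl_unjustified[OF v] jl_dj_def intro: INF_greatest)
  moreover have "v \<notin> justified G J"
    using v by (simp add: justified_def unjustified_def)
  ultimately have "executable G J v dj"
    using J dj by (auto simp: executable_def)
  then show ?thesis by blast
qed

section \<open>Winning justifications without unjustified nodes\<close>

text \<open>Single-valued because a justified node owned by its hypothesis has exactly one outgoing
  edge.\<close>

lemma strategy_justification_strategy:
  assumes G: "parity_game G" and J: "weakly_winning G J"
  shows "strategy G \<alpha> (justification_strategy G J \<alpha>)"
proof -
  have E: "edges J \<subseteq> moves G" using J by (simp add: weakly_winning_def is_justification_def)
  have "w = w'" if e: "(v, w) \<in> edges J" "(v, w') \<in> edges J" "owner G v = hyp J v" for v w w'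
  proof -
    have "v \<in> justified G J"
      using e E G by (auto simp: justified_def out_edges_def parity_game_def)
    then have "winning_dj G (hyp J) (hyp J v) v (out_edges J v)"
      using J by (simp add: weakly_winning_def)
    then obtain x where "out_edges J v = {(v, x)}"
      using e(3) by (auto simp: winning_dj_def direct_justification_def)
    moreover have "(v, w) \<in> out_edges J v" "(v, w') \<in> out_edges J v"
      using e(1,2) by (simp_all add: out_edges_def)
    ultimately show ?thesis by simp
  qed
  then show ?thesis
    using E G by (auto simp: strategy_def justification_strategy_def single_valued_def parity_game_def)
qed

text \<open>A consistent play never leaves \<open>edges J\<close>: at nodes of \<alpha> the strategy
  forces this, at the opponent's nodes all moves belong to \<open>J\<close>. The hypothesis thus
  stays \<alpha>.\<close>

lemma wins_from_justification_strategy: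
  assumes G: "parity_game G" and J: "winning G J" and U: "unjustified G J = {}"
    and v: "v \<in> nodes G" "hyp J v = \<alpha>"
  shows "wins_from G \<alpha> (justification_strategy G J \<alpha>) v"
  unfolding wins_from_def
proof (intro allI impI, elim conjE)
  fix p assume p: "play G p" "p 0 = v" "consistent (justification_strategy G J \<alpha>) p"
  have ww: "weakly_winning G J" using J by (simp add: winning_def)
  have step: "(p i, p (Suc i)) \<in> edges J" if "hyp J (p i) = \<alpha>" for i
  proof -
    have m: "(p i, p (Suc i)) \<in> moves G" using p(1) by (simp add: play_def infinite_path_def)
    then have "p i \<in> nodes G" using G by (auto simp: parity_game_def)
    then have just: "p i \<in> justified G J" using U by (auto simp: justified_def unjustified_def)
    show ?thesis
    proof (cases "owner G (p i) = \<alpha>")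
      case True
      then have "p i \<in> Domain (justification_strategy G J \<alpha>)"
        using just that by (auto simp: justified_def out_edges_def justification_strategy_def)
      then show ?thesis using p(3) by (auto simp: consistent_def justification_strategy_def)
    next
      case False
      moreover have "winning_dj G (hyp J) \<alpha> (p i) (out_edges J (p i))"
        using ww just that by (auto simp: weakly_winning_def)
      ultimately have "out_edges J (p i) = {e \<in> moves G. fst e = p i}"
        by (simp add: winning_dj_def direct_justification_def)
      then have "(p i, p (Suc i)) \<in> out_edges J (p i)" using m by simp
      then show ?thesis by (simp add: out_edges_def)
    qed
  qed
  have "hyp J (p i) = \<alpha>" for i
    by (induction i) (use p(2) v(2) step weakly_winning_hyp_edge[OF G ww] in auto)
  then have "infinite_path (edges J) p" using step by (simp add: infinite_path_def)
  then show "play_winner G p = \<alpha>" using J p(2) v(2) by (simp add: winning_def)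
qed

text \<open>Determinacy is derived here: the player \<open>hyp J v\<close> wins by the extracted
  strategy, and \<open>not_wins_both\<close> excludes the other.\<close>

lemma wins_iff_hyp:
  assumes G: "parity_game G" and J: "winning G J" and U: "unjustified G J = {}"
    and v: "v \<in> nodes G" and \<alpha>: "\<alpha> \<in> {0, 1}"
  shows "wins G \<alpha> v \<longleftrightarrow> hyp J v = \<alpha>"
proof -
  have "wins G (hyp J v) v"
    unfolding wins_def
    using strategy_justification_strategy[OF G] wins_from_justification_strategy[OF G J U v] J
    by (auto simp: winning_def)
  moreover have "hyp J v \<in> {0, 1}"
    using J v by (simp add: winning_def weakly_winning_def is_justification_def)
  ultimately show ?thesis
    using not_wins_both[OF G v] \<alpha> by auto
qed

lemma winning_function_hyp:
  assumes "parity_game G" "winning G J" "unjustified G J = {}"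
  shows "winning_function G (hyp J)"
  using wins_iff_hyp[OF assms] assms(2)
  by (simp add: winning_function_def winning_def weakly_winning_def is_justification_def)

lemma winning_strategy_justification_strategy:
  assumes "parity_game G" "winning G J" "unjustified G J = {}" "\<alpha> \<in> {0, 1}"
  shows "winning_strategy G \<alpha> (justification_strategy G J \<alpha>)"
  using strategy_justification_strategy[OF assms(1)] wins_from_justification_strategy[OF assms(1-3)]
    wins_iff_hyp[OF assms(1-3) _ assms(4)] assms(2)
  by (simp add: winning_strategy_def winning_def)

section \<open>Justification sequences\<close>

text \<open>The total weight is a natural number that grows by at least one per step, so it bounds
  the number of steps taken.\<close>

lemma justify_sequence_invariant:
  assumes G: "parity_game G" and J0: "safe G J0" and Js: "justify_sequence G J0 N Js"
    and i: "enat i \<le> N"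
  shows "safe G (Js i) \<and> i \<le> sum (node_weight G (Js i)) (nodes G)"
  using i
proof (induction i)
  case 0
  then show ?case using J0 Js by (simp add: justify_sequence_def)
next
  case (Suc i)
  then have lt: "enat i < N" by (simp add: Suc_ile_eq)
  then obtain v dj where st: "executable G (Js i) v dj" "Js (Suc i) = Justify G (Js i) v dj"
    using Js by (auto simp: justify_sequence_def)
  show ?case
    using Suc.IH[OF less_imp_le[OF lt]] safe_Justify[OF G st(1)] sum_node_weight_less[OF G st(1)] st(2) by simp
qed

theorem theorem2:
  fixes G :: "'v parity_game"
    and J0 :: "'v justification"
    and N :: enat
    and Js :: "nat \<Rightarrow> 'v justification"
  assumes "parity_game G"
    and "safe G J0"
    and "justify_sequence G J0 N Js"
  shows "\<exists>k. N = enat k \<and>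
           safe G (Js k) \<and>
           unjustified G (Js k) = {} \<and>
           winning_function G (hyp (Js k)) \<and>
           winning_strategy G 0 (justification_strategy G (Js k) 0) \<and>
           winning_strategy G 1 (justification_strategy G (Js k) 1)"
proof (cases N)
  case (enat k)
  have safe: "safe G (Js k)"
    using justify_sequence_invariant[OF assms, of k] enat by simp
  \<comment> \<open>With an unjustified node left the sequence would have to be stuck, which safety
    excludes.\<close>
  have U: "unjustified G (Js k) = {}"
    using exists_executable[OF assms(1) safe] assms(3) enat by (auto simp: justify_sequence_def)
  have "winning G (Js k)" using safe by (simp add: safe_def)
  then show ?thesis
    using enat safe U winning_function_hyp[OF assms(1) _ U]
      winning_strategy_justification_strategy[OF assms(1) _ U] by simp
next
  case infinity
  let ?B = "card (nodes G) * level_weight G \<infinity>"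
  \<comment> \<open>An infinite sequence would make more steps than the largest possible total
    weight.\<close>
  have "Suc ?B \<le> sum (node_weight G (Js (Suc ?B))) (nodes G)"
    using justify_sequence_invariant[OF assms, of "Suc ?B"] infinity by simp
  also have "\<dots> \<le> ?B" by (rule sum_node_weight_le)
  finally show ?thesis by simp
qed

end
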